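(* Let $r\ge0$, let $L\in\mathcal{F}^2$ be a convex-concave function with unique saddle point $z^*=(x^*,y^* )$, and let $F(x,y)=(\nabla_x L(x,y),-\nabla_y L(x,y))$. Let $z_0\in\mathbb{R}^n\times\mathbb{R}^m$ and let $Z=(X,Y):[0,\infty)\to\mathbb{R}^n\times\mathbb{R}^m$ be a solution ($C^1$ on $[0,\infty)$ and $C^2$ on $(0,\infty)$) of $$\ddot Z+\frac{r+3}{t}\dot Z+\frac{t^{r}}{r+2}\nabla F(Z)\dot Z+t^{r-1}F(Z)=0,\qquad t>0,$$ with initial conditions $Z(0)=z_0$ and $\dot Z(0)=0$. Then for all $t>0$, $$L(X(t),y^* )-L(x^*,Y(t))\le\frac{(r+2)^2\|z_0-z^*\|^2}{2t^{r+1}}.$$ Moreover, $$\lim_{t\to\infty}t^{r+1}\bigl(L(X(t),y^* )-L(x^*,Y(t))\bigr)=0.$$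
   Context: For $p\in\{1,2\}$, $\mathcal{F}^p$ denotes the class of $p$-times continuously differentiable functions $L:\mathbb{R}^n\times\mathbb{R}^m\to\mathbb{R}$, $(x,y)\mapsto L(x,y)$, that are convex in $x$ for each $y$ and concave in $y$ for each $x$, and that have a unique saddle point $z^*=(x^*,y^* )$, i.e. $L(x^*,y)\le L(x^*,y^* )\le L(x,y^* )$ for all $x,y$, where the left inequality is an equality if and only if $y=y^*$ and the right inequality is an equality if and only if $x=x^*$. Write $z=(x,y)$; $\nabla F(z)$ denotes the Jacobian matrix of $F$ at $z$; $\|\cdot\|$ is the Euclidean norm. *)

theory Defs
  imports "HOL-Analysis.Analysis"
begin

text \<open>\<open>f\<close> is \<open>k\<close> times continuously (Frechet) differentiable on the whole space: a map is of class
  \<open>C\<^sup>k\<^sup>+\<^sup>1\<close> iff it is differentiable and each of its directional derivatives is of class \<open>C\<^sup>k\<close>.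
  (The library has no notion of class \<open>C\<^sup>k\<close> for maps on Euclidean spaces.)\<close>

primrec k_times_cont_diff ::
    "nat \<Rightarrow> ('a::euclidean_space \<Rightarrow> 'b::real_normed_vector) \<Rightarrow> bool" where
  "k_times_cont_diff 0 f \<longleftrightarrow> continuous_on UNIV f"
| "k_times_cont_diff (Suc k) f \<longleftrightarrow>
     (\<forall>x. f differentiable (at x)) \<and>
     (\<forall>v. k_times_cont_diff k (\<lambda>x. frechet_derivative f (at x) v))"

text \<open>The defining property of the saddle point in the class below. The strictness makes it the only
  saddle point, but is stronger than uniqueness: \<open>L(x,y) = x * y\<close> has the unique saddle point \<open>(0,0)\<close>
  without satisfying it.\<close>

definition unique_saddle_point :: "('a \<times> 'b \<Rightarrow> real) \<Rightarrow> 'a \<times> 'b \<Rightarrow> bool" where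
  "unique_saddle_point L z \<longleftrightarrow> (case z of (xs, ys) \<Rightarrow>
     (\<forall>x y. L (xs, y) \<le> L (xs, ys) \<and> L (xs, ys) \<le> L (x, ys)) \<and>
     (\<forall>y. L (xs, y) = L (xs, ys) \<longleftrightarrow> y = ys) \<and>
     (\<forall>x. L (xs, ys) = L (x, ys) \<longleftrightarrow> x = xs))"

lemma unique_saddle_point_unique:
  assumes "unique_saddle_point L (xs, ys)"
    and "\<And>x y. L (x', y) \<le> L (x', y') \<and> L (x', y') \<le> L (x, y')"
  shows "(x', y') = (xs, ys)"
proof -
  have le: "L (xs, y) \<le> L (xs, ys)" "L (xs, ys) \<le> L (x, ys)"
    and eq: "L (xs, y) = L (xs, ys) \<longleftrightarrow> y = ys" "L (xs, ys) = L (x, ys) \<longleftrightarrow> x = xs" for x y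
    using assms(1) unfolding unique_saddle_point_def by auto
  have "L (xs, ys) \<le> L (x', ys)" "L (x', ys) \<le> L (x', y')"
    "L (x', y') \<le> L (xs, y')" "L (xs, y') \<le> L (xs, ys)"
    using le assms(2) by auto
  then have "L (xs, y') = L (xs, ys)" "L (xs, ys) = L (x', ys)"
    by linarith+
  then show ?thesis
    using eq by simp
qed

text \<open>\<open>saddle_class p\<close> is the class \<open>\<F>\<^sup>p\<close>.\<close>

definition saddle_class :: "nat \<Rightarrow> ((real^'n) \<times> (real^'m) \<Rightarrow> real) set" where
  "saddle_class p = {L. k_times_cont_diff p L \<and>
     (\<forall>y. convex_on UNIV (\<lambda>x. L (x, y))) \<and>
     (\<forall>x. concave_on UNIV (\<lambda>y. L (x, y))) \<and>
     (\<exists>z. unique_saddle_point L z)}"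

definition gradient :: "('a::real_inner \<Rightarrow> real) \<Rightarrow> 'a \<Rightarrow> 'a" where
  "gradient f x = (THE D. GDERIV f x :> D)"

text \<open>\<open>F(x,y) = (\<nabla>\<^sub>x L(x,y), -\<nabla>\<^sub>y L(x,y))\<close>\<close>

definition saddle_op ::
    "((real^'n) \<times> (real^'m) \<Rightarrow> real) \<Rightarrow> (real^'n) \<times> (real^'m) \<Rightarrow> (real^'n) \<times> (real^'m)" where
  "saddle_op L = (\<lambda>(x, y). (gradient (\<lambda>u. L (u, y)) x, - gradient (\<lambda>v. L (x, v)) y))"

end

theory Submission imports Defs begin

text \<open>Put \<open>p = r + 2\<close>, \<open>u = Z - z\<^sup>*\<close>, \<open>G = F(Z)\<close> and \<open>q = u + (t/p) Z'\<close>. By monotonicity of \<open>F\<close>, the energy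
  \<open>|q|\<^sup>2/2 + t\<^sup>r\<^sup>+\<^sup>1 \<langle>G, u\<rangle>/p\<^sup>2\<close> is nonincreasing. The saddle gap is at most \<open>\<langle>G, u\<rangle>\<close>, so this is the
  stated bound, and it also gives \<open>|q| \<le> |u(0)|\<close>. Both \<open>u\<close> and \<open>w = q + t\<^sup>r\<^sup>+\<^sup>1 G/p\<^sup>2\<close> are weighted
  time averages of \<open>q\<close>, because \<open>(t\<^sup>p u)' = p t\<^sup>p\<^sup>-\<^sup>1 q\<close> and \<open>(t w)' = q\<close>; hence \<open>u\<close>, \<open>w\<close> and therefore
  \<open>t\<^sup>r\<^sup>+\<^sup>1 G\<close> are bounded. The gap tends to zero along the bounded trajectory, so \<open>u \<longlongrightarrow> 0\<close> by
  uniqueness of the saddle point, and the scaled gap is at most \<open>|t\<^sup>r\<^sup>+\<^sup>1 G| |u|\<close>.\<close>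

section \<open>Tangent inequality and gradients\<close>

lemma convex_on_above_tangent:
  fixes f :: "'a::real_normed_vector \<Rightarrow> real"
  assumes f: "convex_on UNIV f" and f': "(f has_derivative f') (at x)"
  shows "f x + f' (y - x) \<le> f y"
proof -
  let ?l = "\<lambda>s::real. x + s *\<^sub>R (y - x)"
  \<comment> \<open>On the line through \<open>x\<close> and \<open>y\<close> the claim becomes the
    one-variable tangent inequality at parameter 0, evaluated at parameter 1.\<close>
  have "convex_on UNIV (\<lambda>s. f (?l s))"
  proof (intro convex_onI)
    fix s a b :: real assume s: "0 < s" "s < 1"
    have "?l ((1 - s) *\<^sub>R a + s *\<^sub>R b) = (1 - s) *\<^sub>R ?l a + s *\<^sub>R ?l b"
      by (simp add: algebra_simps)
    with s show "f (?l ((1 - s) *\<^sub>R a + s *\<^sub>R b)) \<le> (1 - s) * f (?l a) + s * f (?l b)"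
      using convex_onD[OF f, of s "?l a" "?l b"] by simp
  qed simp
  moreover have "((\<lambda>s. f (?l s)) has_real_derivative f' (y - x)) (at 0)"
  proof -
    have "(?l has_derivative (\<lambda>s. s *\<^sub>R (y - x))) (at 0)"
      by (auto intro!: derivative_eq_intros)
    from has_derivative_compose[OF this, of f f'] f'
    have "((\<lambda>s. f (?l s)) has_derivative (\<lambda>s. f' (s *\<^sub>R (y - x)))) (at 0)"
      by simp
    then show ?thesis
      using linear_scale[OF has_derivative_linear[OF f']]
      by (simp add: has_field_derivative_def mult_commute_abs)
  qed
  ultimately have "f (?l 1) - f (?l 0) \<ge> f' (y - x) * (1 - 0)"
    by (intro convex_on_imp_above_tangent[where A = UNIV]) auto
  then show ?thesis
    by simp
qed

text \<open>The coordinate vector is a gradient, and any other gradient has the same inner products,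
  so the definite description is resolved. The first form serves differentiability in the base
  point, the second the tangent inequalities.\<close>

lemma gradient_eq:
  fixes f :: "'a::euclidean_space \<Rightarrow> real"
  assumes "(f has_derivative f') (at x)"
  shows "gradient f x = (\<Sum>b\<in>Basis. f' b *\<^sub>R b)" and "gradient f x \<bullet> v = f' v"
proof -
  let ?D = "\<Sum>b\<in>Basis. f' b *\<^sub>R b"
  interpret linear f' using assms by (rule has_derivative_linear)
  have D: "v \<bullet> ?D = f' v" for v
  proof -
    have "f' v = f' (\<Sum>b\<in>Basis. (v \<bullet> b) *\<^sub>R b)"
      by (simp add: euclidean_representation)
    also have "\<dots> = v \<bullet> ?D"
      by (simp add: sum scale inner_sum_right mult.commute)
    finally show ?thesis by simp
  qed
  have "GDERIV f x :> ?D"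
    using assms by (simp add: gderiv_def D)
  moreover have "D = ?D" if "GDERIV f x :> D" for D
  proof -
    have "(\<lambda>h. h \<bullet> D) = f'"
      using that assms unfolding gderiv_def by (rule has_derivative_unique)
    then have "h \<bullet> D = h \<bullet> ?D" for h
      by (metis D)
    then show ?thesis
      by (metis vector_eq_rdot inner_commute)
  qed
  ultimately show "gradient f x = ?D"
    unfolding gradient_def by (rule the_equality)
  then show "gradient f x \<bullet> v = f' v"
    by (metis D inner_commute)
qed

section \<open>The operator of a convex-concave function\<close>

context
  fixes L :: "(real^'n) \<times> (real^'m) \<Rightarrow> real"
  assumes L: "L \<in> saddle_class 2"
begin

lemma L_has_derivative: "(L has_derivative frechet_derivative L (at z)) (at z)"
proof -
  have "k_times_cont_diff (Suc (Suc 0)) L"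
    using L by (simp add: saddle_class_def numeral_2_eq_2 del: k_times_cont_diff.simps)
  then show ?thesis
    by (simp add: frechet_derivative_works del: split_paired_All)
qed

lemma frechet_derivative_L_differentiable:
  "(\<lambda>z. frechet_derivative L (at z) v) differentiable (at z)"
proof -
  have "k_times_cont_diff (Suc (Suc 0)) L"
    using L by (simp add: saddle_class_def numeral_2_eq_2 del: k_times_cont_diff.simps)
  then show ?thesis
    by (simp del: split_paired_All)
qed

lemma L_partial_fst:
  "((\<lambda>u. L (u, y)) has_derivative (\<lambda>h. frechet_derivative L (at (x, y)) (h, 0))) (at x)"
proof -
  have "((\<lambda>u. (u, y)) has_derivative (\<lambda>h. (h, 0))) (at x)"
    by (auto intro!: derivative_eq_intros)
  from has_derivative_compose[OF this L_has_derivative] show ?thesis .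
qed

lemma L_partial_snd:
  "((\<lambda>v. L (x, v)) has_derivative (\<lambda>h. frechet_derivative L (at (x, y)) (0, h))) (at y)"
proof -
  have "((\<lambda>v. (x, v)) has_derivative (\<lambda>h. (0, h))) (at y)"
    by (auto intro!: derivative_eq_intros)
  from has_derivative_compose[OF this L_has_derivative] show ?thesis .
qed

text \<open>Here second-order smoothness enters: both components are finite combinations of
  directional derivatives of \<open>L\<close> taken at the joint point \<open>z\<close>, each of
  which is differentiable.\<close>

lemma saddle_op_differentiable: "saddle_op L differentiable (at z)"
proof -
  have "saddle_op L = (\<lambda>z.
    ((\<Sum>b\<in>Basis. frechet_derivative L (at z) (b, 0) *\<^sub>R b),
     - (\<Sum>b\<in>Basis. frechet_derivative L (at z) (0, b) *\<^sub>R b)))"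
    by (auto simp: saddle_op_def fun_eq_iff
        gradient_eq(1)[OF L_partial_fst] gradient_eq(1)[OF L_partial_snd])
  moreover have "(\<lambda>z. \<Sum>b\<in>Basis. frechet_derivative L (at z) (b, 0) *\<^sub>R b) differentiable (at z)"
      "(\<lambda>z. - (\<Sum>b\<in>Basis. frechet_derivative L (at z) (0, b) *\<^sub>R b)) differentiable (at z)"
    by (intro differentiable_minus differentiable_sum finite_Basis ballI differentiable_scaleR
        frechet_derivative_L_differentiable differentiable_const)+
  ultimately show ?thesis
    unfolding differentiable_def by (auto intro: has_derivative_Pair)
qed

text \<open>Add the tangent inequalities for the convex functions \<open>L (_, y)\<close> at
  \<open>x\<close> and \<open>- L (x, _)\<close> at \<open>y\<close>; the value
  \<open>L (x, y)\<close> cancels. With a saddle point as \<open>(x', y')\<close> the left side is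
  the saddle gap.\<close>

lemma saddle_op_gap:
  "L (x, y') - L (x', y) \<le> saddle_op L (x, y) \<bullet> ((x, y) - (x', y'))"
proof -
  have conv: "convex_on UNIV (\<lambda>u. L (u, y))" "convex_on UNIV (\<lambda>v. - L (x, v))"
    using L by (auto simp: saddle_class_def concave_on_def)
  have "L (x, y) + gradient (\<lambda>u. L (u, y)) x \<bullet> (x' - x) \<le> L (x', y)"
    unfolding gradient_eq(2)[OF L_partial_fst]
    by (rule convex_on_above_tangent[OF conv(1) L_partial_fst])
  moreover have "- L (x, y) + - (gradient (\<lambda>v. L (x, v)) y \<bullet> (y' - y)) \<le> - L (x, y')"
    unfolding gradient_eq(2)[OF L_partial_snd]
    by (rule convex_on_above_tangent[OF conv(2) has_derivative_minus[OF L_partial_snd]])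
  ultimately show ?thesis
    by (simp add: saddle_op_def inner_diff_right)
qed

text \<open>Exchanging the two points in \<open>saddle_op_gap\<close> reverses the sign of its left
  side, so the sum of both instances has left side 0.\<close>

lemma saddle_op_mono: "0 \<le> (saddle_op L z - saddle_op L z') \<bullet> (z - z')"
  using saddle_op_gap[of "fst z" "snd z'" "fst z'" "snd z"]
    saddle_op_gap[of "fst z'" "snd z" "fst z" "snd z'"]
  by (simp add: inner_diff_left inner_diff_right)

lemma L_continuous: "continuous_on UNIV L"
  using has_derivative_continuous[OF L_has_derivative]
  by (intro continuous_at_imp_continuous_on ballI)

end

section \<open>Derivatives and limits of curves\<close>

lemma has_vector_derivative_tendsto_quotient:
  assumes "(h has_vector_derivative h') (at t)"
  shows "((\<lambda>s. (h s - h t) /\<^sub>R (s - t)) \<longlongrightarrow> h') (at t)"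
proof -
  have "((\<lambda>s. norm ((h s - h t - (s - t) *\<^sub>R h') /\<^sub>R norm (s - t))) \<longlongrightarrow> 0) (at t)"
    using assms by (intro tendsto_norm_zero) (simp add: has_vector_derivative_def has_derivative_at_within)
  moreover have "\<forall>\<^sub>F s in at t. norm ((h s - h t - (s - t) *\<^sub>R h') /\<^sub>R norm (s - t))
      = norm ((h s - h t) /\<^sub>R (s - t) - h')"
  proof (rule eventually_mono[OF eventually_neq_at_within[of t]])
    fix s assume "s \<noteq> t"
    then have "(h s - h t) /\<^sub>R (s - t) - h' = (h s - h t - (s - t) *\<^sub>R h') /\<^sub>R (s - t)"
      by (simp add: scaleR_diff_right)
    then show "norm ((h s - h t - (s - t) *\<^sub>R h') /\<^sub>R norm (s - t))
      = norm ((h s - h t) /\<^sub>R (s - t) - h')"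
      by simp
  qed
  ultimately have "((\<lambda>s. norm ((h s - h t) /\<^sub>R (s - t) - h')) \<longlongrightarrow> 0) (at t)"
    by (rule Lim_transform_eventually)
  then show ?thesis
    by (simp add: Lim_null[of _ h'] tendsto_norm_zero_iff)
qed

text \<open>The pairing of the two difference quotients is the monotonicity expression times a
  square, and its sign survives the limit. For \<open>G\<close> and \<open>Z\<close> this yields the
  sign of \<open>G' t \<bullet> Z' t\<close> from monotonicity along the trajectory alone.\<close>

lemma has_vector_derivative_inner_nonneg:
  fixes f g :: "real \<Rightarrow> 'a::real_inner"
  assumes f: "(f has_vector_derivative f') (at t)" and g: "(g has_vector_derivative g') (at t)"
    and mono: "\<And>s. 0 \<le> (f s - f t) \<bullet> (g s - g t)"
  shows "0 \<le> f' \<bullet> g'"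
proof -
  have "((\<lambda>s. ((f s - f t) /\<^sub>R (s - t)) \<bullet> ((g s - g t) /\<^sub>R (s - t))) \<longlongrightarrow> f' \<bullet> g') (at t)"
    by (intro tendsto_inner has_vector_derivative_tendsto_quotient f g)
  then show ?thesis
  proof (rule tendsto_lowerbound)
    show "\<forall>\<^sub>F s in at t. 0 \<le> ((f s - f t) /\<^sub>R (s - t)) \<bullet> ((g s - g t) /\<^sub>R (s - t))"
    proof (intro always_eventually allI)
      fix s
      have "((f s - f t) /\<^sub>R (s - t)) \<bullet> ((g s - g t) /\<^sub>R (s - t))
        = ((f s - f t) \<bullet> (g s - g t)) * (inverse (s - t))\<^sup>2"
        by (simp add: power2_eq_square)
      also have "0 \<le> \<dots>"
        by (intro mult_nonneg_nonneg mono zero_le_power2)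
      finally show "0 \<le> ((f s - f t) /\<^sub>R (s - t)) \<bullet> ((g s - g t) /\<^sub>R (s - t))" .
    qed
  qed simp
qed

text \<open>Outside a neighbourhood \<open>S\<close> of \<open>z\<close>, compactness gives \<Phi> a
  positive lower bound on \<open>K\<close>; once \<open>\<Phi> (f t)\<close> falls below it,
  \<open>f t\<close> lies in \<open>S\<close>.\<close>

lemma tendsto_of_unique_zero:
  fixes f :: "real \<Rightarrow> 'a::heine_borel" and \<Phi> :: "'a \<Rightarrow> real"
  assumes bnd: "\<And>t. t > 0 \<Longrightarrow> f t \<in> K" and K: "compact K"
    and \<Phi>: "continuous_on K \<Phi>" and pos: "\<And>x. x \<in> K \<Longrightarrow> x \<noteq> z \<Longrightarrow> 0 < \<Phi> x"
    and lim: "((\<lambda>t. \<Phi> (f t)) \<longlongrightarrow> 0) at_top"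
  shows "(f \<longlongrightarrow> z) at_top"
proof (rule topological_tendstoI)
  fix S assume S: "open S" "z \<in> S"
  have "\<exists>m>0. \<forall>x\<in>K - S. m \<le> \<Phi> x"
  proof (cases "K - S = {}")
    case True then show ?thesis by (intro exI[of _ 1]) auto
  next
    case False
    have "compact (K - S)" using K S(1) by (rule compact_diff)
    then obtain x where "x \<in> K - S" "\<forall>y\<in>K - S. \<Phi> x \<le> \<Phi> y"
      using continuous_attains_inf[OF _ False, of \<Phi>] continuous_on_subset[OF \<Phi>] by blast
    then show ?thesis using pos[of x] S(2) by blast
  qed
  then obtain m where m: "m > 0" "\<And>x. x \<in> K - S \<Longrightarrow> m \<le> \<Phi> x" by blast
  from order_tendstoD(2)[OF lim m(1)] eventually_gt_at_top[of 0]
  show "\<forall>\<^sub>F t in at_top. f t \<in> S"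
    by eventually_elim (use m(2) bnd in force)
qed

section \<open>Energy and averaging estimates for the inertial flow\<close>

lemmas has_vector_derivative_inner =
  bounded_bilinear.has_vector_derivative[OF bounded_bilinear_inner]

text \<open>Continuity up to 0 is the point: the equation holds for positive times only, while the
  estimates compare with time 0.\<close>

lemma continuous_on_powr_pos: "0 < a \<Longrightarrow> continuous_on {0..b::real} (\<lambda>t. t powr a)"
  by (intro continuous_on_powr') (auto intro!: continuous_intros)

text \<open>Of the operator only the curve \<open>G\<close> and two signs remain:
  \<open>G_nonneg\<close> will come from the saddle gap, \<open>G'_nonneg\<close> from
  monotonicity.\<close>

locale inertial_flow =
  fixes r :: real and zs :: "'a::real_inner" and Z Z' Z'' G G' :: "real \<Rightarrow> 'a"
  assumes r: "r \<ge> 0"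
    and Z_cont: "continuous_on {0..} Z"
    and Z'_cont: "continuous_on {0..} Z'"
    and G_cont: "continuous_on {0..} G"
    and Z': "\<And>t. t > 0 \<Longrightarrow> (Z has_vector_derivative Z' t) (at t)"
    and Z'': "\<And>t. t > 0 \<Longrightarrow> (Z' has_vector_derivative Z'' t) (at t)"
    and G': "\<And>t. t > 0 \<Longrightarrow> (G has_vector_derivative G' t) (at t)"
    and ode: "\<And>t. t > 0 \<Longrightarrow>
      Z'' t + ((r + 3) / t) *\<^sub>R Z' t + (t powr r / (r + 2)) *\<^sub>R G' t
        + (t powr (r - 1)) *\<^sub>R G t = 0"
    and G_nonneg: "\<And>t. t > 0 \<Longrightarrow> 0 \<le> G t \<bullet> (Z t - zs)"
    and G'_nonneg: "\<And>t. t > 0 \<Longrightarrow> 0 \<le> G' t \<bullet> Z' t"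
begin

definition q :: "real \<Rightarrow> 'a" where
  "q t = (Z t - zs) + (t / (r + 2)) *\<^sub>R Z' t"

definition w :: "real \<Rightarrow> 'a" where
  "w t = q t + (t powr (r + 1) / (r + 2)\<^sup>2) *\<^sub>R G t"

definition energy :: "real \<Rightarrow> real" where
  "energy t = q t \<bullet> q t / 2 + t powr (r + 1) * (G t \<bullet> (Z t - zs)) / (r + 2)\<^sup>2"

lemma cont:
  "continuous_on {0..t} Z" "continuous_on {0..t} Z'" "continuous_on {0..t} G"
  using Z_cont Z'_cont G_cont by (auto intro: continuous_on_subset)

lemma q_cont: "continuous_on {0..t} q"
  unfolding q_def using r by (intro continuous_intros cont) auto

lemma w_cont: "continuous_on {0..t} w"
  unfolding w_def using r by (intro continuous_intros cont q_cont continuous_on_powr_pos) auto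

lemma energy_cont: "continuous_on {0..t} energy"
  unfolding energy_def using r by (intro continuous_intros cont q_cont continuous_on_powr_pos) auto

text \<open>With \<open>t powr (r - 1)\<close> as a common atom, the identities below become
  rational in \<open>t\<close>.\<close>

lemma powr_shift:
  assumes "t > 0"
  shows "t powr r = t * t powr (r - 1)" "t powr (r + 1) = t\<^sup>2 * t powr (r - 1)"
    "t powr (r + 2) = t ^ 3 * t powr (r - 1)"
proof -
  have "t powr (r - 1) = t powr r / t" "t powr (r + 1) = t powr r * t"
    "t powr (r + 2) = t powr r * t\<^sup>2"
    using assms by (simp_all add: powr_diff powr_add)
  then show "t powr r = t * t powr (r - 1)" "t powr (r + 1) = t\<^sup>2 * t powr (r - 1)"
    "t powr (r + 2) = t ^ 3 * t powr (r - 1)"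
    using assms by (simp_all add: power2_eq_square power3_eq_cube)
qed

text \<open>In the equation multiplied by \<open>t / (r + 2)\<close>, damping contributes
  -(r+3)/(r+2) times \<open>Z' t\<close>. This cancels the velocity terms from differentiating
  \<open>Z\<close> and the factor \<open>t / (r + 2)\<close> in \<open>q\<close>.\<close>

lemma q_deriv:
  assumes "t > 0"
  shows "(q has_vector_derivative
     - (t powr (r + 1) / (r + 2)\<^sup>2) *\<^sub>R G' t - (t powr r / (r + 2)) *\<^sub>R G t) (at t)"
proof -
  have "Z'' t = - ((r + 3) / t) *\<^sub>R Z' t - (t powr r / (r + 2)) *\<^sub>R G' t
        - (t powr (r - 1)) *\<^sub>R G t"
    by (rule iffD1[OF right_minus_eq], subst ode[OF assms, symmetric]) simp
  then have "(t / (r + 2)) *\<^sub>R Z'' t = - ((r + 3) / (r + 2)) *\<^sub>R Z' t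
      - (t powr (r + 1) / (r + 2)\<^sup>2) *\<^sub>R G' t - (t powr r / (r + 2)) *\<^sub>R G t"
    using assms r by (simp add: powr_shift power2_eq_square scaleR_diff_right)
  moreover have "Z' t + (1 / (r + 2)) *\<^sub>R Z' t = ((r + 3) / (r + 2)) *\<^sub>R Z' t"
    unfolding scaleR_left_distrib[of 1 "1 / (r + 2)" "Z' t", simplified, symmetric]
    using r by (simp add: field_simps)
  ultimately have "(Z' t + (1 / (r + 2)) *\<^sub>R Z' t) + (t / (r + 2)) *\<^sub>R Z'' t
     = - (t powr (r + 1) / (r + 2)\<^sup>2) *\<^sub>R G' t - (t powr r / (r + 2)) *\<^sub>R G t"
    by (simp only:) simp
  moreover have "(q has_vector_derivative (Z' t + (1 / (r + 2)) *\<^sub>R Z' t) + (t / (r + 2)) *\<^sub>R Z'' t) (at t)"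
    unfolding q_def using r
    by (auto intro!: derivative_eq_intros Z'[OF assms] Z''[OF assms])
  ultimately show ?thesis
    by (simp only:)
qed

text \<open>The pairings of \<open>G\<close> with \<open>Z'\<close> and of \<open>G'\<close> with
  \<open>Z - zs\<close> cancel between the two summands of the energy. For \<open>G\<close> against
  \<open>Z - zs\<close> the coefficient left is (r+1)/(r+2)^2 - 1/(r+2) = -1/(r+2)^2, times
  \<open>t powr r\<close>.\<close>

lemma energy_deriv:
  assumes "t > 0"
  shows "(energy has_real_derivative
     - (t powr r / (r + 2)\<^sup>2) * (G t \<bullet> (Z t - zs))
     - (t powr (r + 2) / (r + 2) ^ 3) * (G' t \<bullet> Z' t)) (at t)"
proof -
  have pow: "((\<lambda>t. t powr (r + 1)) has_real_derivative (r + 1) * t powr r) (at t)"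
    using has_real_derivative_powr[OF assms, of "r + 1"] by simp
  have Zd: "((\<lambda>t. Z t - zs) has_vector_derivative Z' t) (at t)"
    using Z'[OF assms] by (auto intro!: derivative_eq_intros)
  note qd = q_deriv[OF assms]
  note Gd = G'[OF assms]
  have q2: "((\<lambda>t. q t \<bullet> q t) has_real_derivative
      2 * (q t \<bullet> (- (t powr (r + 1) / (r + 2)\<^sup>2) *\<^sub>R G' t - (t powr r / (r + 2)) *\<^sub>R G t))) (at t)"
    unfolding has_real_derivative_iff_has_vector_derivative
    using has_vector_derivative_inner[OF qd qd] by (simp add: inner_commute)
  have gz: "((\<lambda>t. G t \<bullet> (Z t - zs)) has_real_derivative G t \<bullet> Z' t + G' t \<bullet> (Z t - zs)) (at t)"
    unfolding has_real_derivative_iff_has_vector_derivative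
    using has_vector_derivative_inner[OF Gd Zd] by simp
  define u a where "u = Z t - zs" and "a = t powr (r - 1)"
  define p where "p = r + 2"
  have p: "p > 0" "r = p - 2" using r by (auto simp: p_def)
  have e: "t powr r = t * a" "t powr (r + 1) = t\<^sup>2 * a" "t powr (r + 2) = t ^ 3 * a"
    unfolding a_def using assms by (rule powr_shift)+
  show ?thesis
    unfolding energy_def
  proof (rule DERIV_cong[OF DERIV_add[OF DERIV_cdivide[OF q2] DERIV_cdivide[OF DERIV_mult[OF pow gz]]]])
    show "2 * (q t \<bullet> (- (t powr (r + 1) / (r + 2)\<^sup>2) *\<^sub>R G' t - (t powr r / (r + 2)) *\<^sub>R G t)) / 2 +
      ((r + 1) * t powr r * (G t \<bullet> (Z t - zs)) + (G t \<bullet> Z' t + G' t \<bullet> (Z t - zs)) * t powr (r + 1)) / (r + 2)\<^sup>2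
      = - (t powr r / (r + 2)\<^sup>2) * (G t \<bullet> (Z t - zs)) - (t powr (r + 2) / (r + 2) ^ 3) * (G' t \<bullet> Z' t)"
      unfolding e unfolding q_def u_def[symmetric] p_def[symmetric]
        inner_left_distrib inner_diff_right inner_scaleR_left inner_scaleR_right
      using p by (simp add: inner_commute power2_eq_square power3_eq_cube divide_simps)
        (simp add: algebra_simps)
  qed
qed

lemma energy_le:
  assumes "t > 0"
  shows "energy t \<le> (norm (Z 0 - zs))\<^sup>2 / 2"
proof -
  have "energy t \<le> energy 0"
  proof (rule DERIV_nonpos_imp_decreasing_open[OF _ _ energy_cont])
    fix s :: real assume s: "0 < s"
    show "\<exists>y. DERIV energy s :> y \<and> y \<le> 0"
    proof (intro exI conjI)
      have "0 \<le> (s powr r / (r + 2)\<^sup>2) * (G s \<bullet> (Z s - zs))"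
        "0 \<le> (s powr (r + 2) / (r + 2) ^ 3) * (G' s \<bullet> Z' s)"
        using G_nonneg[OF s] G'_nonneg[OF s] r by auto
      then show "- (s powr r / (r + 2)\<^sup>2) * (G s \<bullet> (Z s - zs))
        - (s powr (r + 2) / (r + 2) ^ 3) * (G' s \<bullet> Z' s) \<le> 0"
        by linarith
    qed (rule energy_deriv[OF s])
  qed (use assms in simp)
  \<comment> \<open>At time 0 the factor \<open>t / (r + 2)\<close> removes the velocity from
    \<open>q\<close>, and \<open>0 powr (r + 1)\<close> is 0.\<close>
  then show ?thesis
    by (simp add: energy_def q_def dot_square_norm)
qed

lemma weighted_gap_le:
  assumes "t > 0"
  shows "t powr (r + 1) * (G t \<bullet> (Z t - zs)) \<le> (r + 2)\<^sup>2 * (norm (Z 0 - zs))\<^sup>2 / 2"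
proof -
  have "t powr (r + 1) * (G t \<bullet> (Z t - zs)) / (r + 2)\<^sup>2 \<le> energy t"
    by (simp add: energy_def)
  with energy_le[OF assms]
  have "t powr (r + 1) * (G t \<bullet> (Z t - zs)) / (r + 2)\<^sup>2 \<le> (norm (Z 0 - zs))\<^sup>2 / 2"
    by linarith
  then show ?thesis
    using r by (simp add: field_simps)
qed

lemma norm_q_le:
  assumes "t > 0"
  shows "norm (q t) \<le> norm (Z 0 - zs)"
proof -
  have "(norm (q t))\<^sup>2 / 2 \<le> energy t"
    using G_nonneg[OF assms] by (simp add: energy_def dot_square_norm)
  with energy_le[OF assms] have "(norm (q t))\<^sup>2 \<le> (norm (Z 0 - zs))\<^sup>2"
    by linarith
  then show ?thesis
    by (simp add: power2_le_iff_abs_le)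
qed

text \<open>By \<open>norm_q_le\<close> the curve
  \<open>t powr (r + 2) *\<^sub>R (Z t - zs)\<close>, which starts at 0, moves no faster than
  \<open>t powr (r + 2) * d\<close>. The mean value inequality compares the two, and the power is
  divided out.\<close>

lemma norm_Z_le:
  assumes "t > 0"
  shows "norm (Z t - zs) \<le> norm (Z 0 - zs)"
proof -
  define d where "d = norm (Z 0 - zs)"
  have "norm (t powr (r + 2) *\<^sub>R (Z t - zs) - 0 powr (r + 2) *\<^sub>R (Z 0 - zs))
    \<le> t powr (r + 2) * d - 0 powr (r + 2) * d"
  proof (rule differentiable_bound_general[OF assms])
    fix s :: real assume s: "0 < s"
    have pow: "((\<lambda>t. t powr (r + 2)) has_real_derivative (r + 2) * s powr (r + 1)) (at s)"
      using has_real_derivative_powr[OF s, of "r + 2"] by (simp add: add.commute)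
    show "((\<lambda>s. s powr (r + 2) * d) has_vector_derivative (r + 2) * s powr (r + 1) * d) (at s)"
      unfolding has_real_derivative_iff_has_vector_derivative[symmetric]
      by (rule DERIV_cmult_right[OF pow])
    have e: "(r + 2) * s powr (r + 1) * (s / (r + 2)) = s powr (r + 2)"
      using s r by (simp add: powr_shift power2_eq_square power3_eq_cube)
    have "((\<lambda>s. s powr (r + 2) *\<^sub>R (Z s - zs)) has_vector_derivative
      s powr (r + 2) *\<^sub>R Z' s + ((r + 2) * s powr (r + 1)) *\<^sub>R (Z s - zs)) (at s)"
      using has_vector_derivative_scaleR[OF pow
          has_vector_derivative_diff[OF Z'[OF s] has_vector_derivative_const]]
      by simp
    then show "((\<lambda>s. s powr (r + 2) *\<^sub>R (Z s - zs)) has_vector_derivative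
      ((r + 2) * s powr (r + 1)) *\<^sub>R q s) (at s)"
      unfolding q_def scaleR_add_right scaleR_scaleR e by (simp add: add.commute)
    show "norm (((r + 2) * s powr (r + 1)) *\<^sub>R q s) \<le> (r + 2) * s powr (r + 1) * d"
      using norm_q_le[OF s] r by (simp add: d_def mult_left_mono abs_mult)
  qed (use r in \<open>intro continuous_intros cont continuous_on_powr_pos; simp\<close>)+
  then show ?thesis
    using assms r by (simp add: d_def)
qed

lemma norm_w_le:
  assumes "t > 0"
  shows "norm (w t) \<le> norm (Z 0 - zs)"
proof -
  define d where "d = norm (Z 0 - zs)"
  have "norm (t *\<^sub>R w t - 0 *\<^sub>R w 0) \<le> t * d - 0 * d"
  proof (rule differentiable_bound_general[OF assms])
    fix s :: real assume s: "0 < s"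
    have pow: "((\<lambda>t. t powr (r + 1)) has_real_derivative (r + 1) * s powr r) (at s)"
      using has_real_derivative_powr[OF s, of "r + 1"] by simp
    show "((\<lambda>s. s * d) has_vector_derivative d) (at s)"
      unfolding has_real_derivative_iff_has_vector_derivative[symmetric]
      by (auto intro!: derivative_eq_intros)
    have "(w has_vector_derivative
      (- (s powr (r + 1) / (r + 2)\<^sup>2) *\<^sub>R G' s - (s powr r / (r + 2)) *\<^sub>R G s)
      + ((s powr (r + 1) / (r + 2)\<^sup>2) *\<^sub>R G' s + ((r + 1) * s powr r / (r + 2)\<^sup>2) *\<^sub>R G s)) (at s)"
      unfolding w_def
      by (intro has_vector_derivative_add q_deriv[OF s] has_vector_derivative_scaleR
         DERIV_cdivide pow G'[OF s])
    \<comment> \<open>The weight 1/(r+2)^2 in \<open>w\<close> is what cancels \<open>G'\<close>.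
      The remaining multiple of \<open>G s\<close>, times \<open>s\<close>, then cancels the
      \<open>G\<close> term of \<open>w\<close> itself and leaves \<open>q s\<close>.\<close>
    also have "(- (s powr (r + 1) / (r + 2)\<^sup>2) *\<^sub>R G' s - (s powr r / (r + 2)) *\<^sub>R G s)
      + ((s powr (r + 1) / (r + 2)\<^sup>2) *\<^sub>R G' s + ((r + 1) * s powr r / (r + 2)\<^sup>2) *\<^sub>R G s)
      = ((r + 1) * s powr r / (r + 2)\<^sup>2 - s powr r / (r + 2)) *\<^sub>R G s"
      by (simp add: algebra_simps)
    also have "(r + 1) * s powr r / (r + 2)\<^sup>2 - s powr r / (r + 2) = - (s powr r / (r + 2)\<^sup>2)"
      using r by (simp add: divide_simps power2_eq_square) (simp add: algebra_simps)
    finally have wd: "(w has_vector_derivative - (s powr r / (r + 2)\<^sup>2) *\<^sub>R G s) (at s)" .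
    have "((\<lambda>s. s *\<^sub>R w s) has_vector_derivative
       s *\<^sub>R (- (s powr r / (r + 2)\<^sup>2) *\<^sub>R G s) + 1 *\<^sub>R w s) (at s)"
      by (intro has_vector_derivative_scaleR wd) (auto intro!: derivative_eq_intros)
    moreover have "s *\<^sub>R (- (s powr r / (r + 2)\<^sup>2) *\<^sub>R G s) + 1 *\<^sub>R w s = q s"
      using s by (simp add: w_def powr_shift power2_eq_square)
    ultimately show "((\<lambda>s. s *\<^sub>R w s) has_vector_derivative q s) (at s)"
      by simp
    show "norm (q s) \<le> d"
      using norm_q_le[OF s] by (simp add: d_def)
  qed (intro continuous_intros w_cont)+
  then show ?thesis
    using assms by (simp add: d_def)
qed

text \<open>The difference \<open>w t - q t\<close> is the scaled \<open>G t\<close>, and both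
  vectors lie in the same ball. This controls \<open>G\<close> itself, not only its pairing with
  \<open>Z - zs\<close>.\<close>

lemma norm_G_le:
  assumes "t > 0"
  shows "t powr (r + 1) * norm (G t) \<le> 2 * (r + 2)\<^sup>2 * norm (Z 0 - zs)"
proof -
  have "norm ((t powr (r + 1) / (r + 2)\<^sup>2) *\<^sub>R G t) = norm (w t - q t)"
    by (simp add: w_def)
  also have "\<dots> \<le> 2 * norm (Z 0 - zs)"
    using norm_triangle_ineq4[of "w t" "q t"] norm_w_le[OF assms] norm_q_le[OF assms] by linarith
  finally show ?thesis
    using r by (simp add: field_simps)
qed

end

section \<open>The convergence theorem\<close>

theorem theorem3p1:
  fixes r :: real
    and L :: "(real^'n) \<times> (real^'m) \<Rightarrow> real"
    and xs :: "real^'n" and ys :: "real^'m"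
    and z0 :: "(real^'n) \<times> (real^'m)"
    and Z Z' Z'' :: "real \<Rightarrow> (real^'n) \<times> (real^'m)"
  assumes r: "r \<ge> 0"
    and L: "L \<in> saddle_class 2"
    and saddle: "unique_saddle_point L (xs, ys)"
    and Z': "\<And>t. t \<ge> 0 \<Longrightarrow> (Z has_vector_derivative Z' t) (at t within {0..})"
    and Z'_cont: "continuous_on {0..} Z'"
    and Z'': "\<And>t. t > 0 \<Longrightarrow> (Z' has_vector_derivative Z'' t) (at t)"
    and Z''_cont: "continuous_on {0<..} Z''"
    and ode: "\<And>t. t > 0 \<Longrightarrow>
      Z'' t + ((r + 3) / t) *\<^sub>R Z' t
        + (t powr r / (r + 2)) *\<^sub>R frechet_derivative (saddle_op L) (at (Z t)) (Z' t)
        + (t powr (r - 1)) *\<^sub>R saddle_op L (Z t) = 0"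
    and init: "Z 0 = z0" "Z' 0 = 0"
  shows "(\<forall>t>0. L (fst (Z t), ys) - L (xs, snd (Z t))
            \<le> (r + 2)\<^sup>2 * (norm (z0 - (xs, ys)))\<^sup>2 / (2 * t powr (r + 1))) \<and>
         ((\<lambda>t. t powr (r + 1) * (L (fst (Z t), ys) - L (xs, snd (Z t)))) \<longlongrightarrow> 0) at_top"
proof -
  define G where "G = (\<lambda>t. saddle_op L (Z t))"
  define G' where "G' = (\<lambda>t. frechet_derivative (saddle_op L) (at (Z t)) (Z' t))"
  define gap where "gap = (\<lambda>z. L (fst z, ys) - L (xs, snd z))"
  \<comment> \<open>The ball in which \<open>norm_Z_le\<close> confines the trajectory.\<close>
  define K where "K = cball (xs, ys) (norm (z0 - (xs, ys)))"
  have saddle_le: "L (xs, y) \<le> L (xs, ys)" "L (xs, ys) \<le> L (x, ys)"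
    and saddle_eq: "L (xs, y) = L (xs, ys) \<longleftrightarrow> y = ys" "L (xs, ys) = L (x, ys) \<longleftrightarrow> x = xs" for x y
    using saddle unfolding unique_saddle_point_def by auto
  have gap_nonneg: "0 \<le> gap z" for z
    using order_trans[OF saddle_le] by (simp add: gap_def)
  have gap_pos: "0 < gap z" if "z \<noteq> (xs, ys)" for z
  proof (rule ccontr)
    \<comment> \<open>Otherwise both saddle inequalities are equalities, and their strictness
      identifies both components of \<open>z\<close>.\<close>
    assume "\<not> 0 < gap z"
    then have "L (xs, snd z) = L (xs, ys)" "L (xs, ys) = L (fst z, ys)"
      using saddle_le(1)[of "snd z"] saddle_le(2)[of "fst z"] unfolding gap_def by linarith+
    then have "snd z = ys" "fst z = xs"
      by (simp_all only: saddle_eq)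
    with that show False
      by (simp add: prod_eq_iff)
  qed
  have gap_le: "gap (Z t) \<le> G t \<bullet> (Z t - (xs, ys))" for t
    using saddle_op_gap[OF L, of "fst (Z t)" ys xs "snd (Z t)"] by (simp add: gap_def G_def)
  have Z'_at: "(Z has_vector_derivative Z' t) (at t)" if "t > 0" for t
    using Z'[of t] that at_within_interior[of t "{0..}"] by simp
  have G'_at: "(G has_vector_derivative G' t) (at t)" if "t > 0" for t
  proof -
    have "(saddle_op L has_derivative frechet_derivative (saddle_op L) (at (Z t))) (at (Z t))"
      using saddle_op_differentiable[OF L] by (simp add: frechet_derivative_works)
    \<comment> \<open>The chain rule used here asks for the outer derivative within the image of
      \<open>Z\<close>.\<close>
    from has_derivative_at_withinI[OF this, of "range Z"] show ?thesis
      using vector_derivative_diff_chain_within[OF Z'_at[OF that]] by (simp add: G_def G'_def o_def)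
  qed
  have Z_cont: "continuous_on {0..} Z"
    using Z' by (intro continuous_on_vector_derivative) auto
  interpret inertial_flow r "(xs, ys)" Z Z' Z'' G G'
  proof
    have "continuous_on UNIV (saddle_op L)"
      using differentiable_imp_continuous_within[OF saddle_op_differentiable[OF L]]
      by (intro continuous_at_imp_continuous_on ballI)
    then show "continuous_on {0..} G"
      unfolding G_def using Z_cont by (rule continuous_on_compose2) simp
    show "0 \<le> G t \<bullet> (Z t - (xs, ys))" for t
      using gap_nonneg gap_le by (rule order_trans)
    show "0 \<le> G' t \<bullet> Z' t" if "t > 0" for t
      using G'_at[OF that] Z'_at[OF that]
      by (rule has_vector_derivative_inner_nonneg) (simp add: G_def saddle_op_mono[OF L])
  qed (use r Z_cont Z'_cont Z'_at Z'' G'_at ode in \<open>simp_all add: G_def G'_def\<close>)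
  have bound: "gap (Z t) \<le> (r + 2)\<^sup>2 * (norm (z0 - (xs, ys)))\<^sup>2 / (2 * t powr (r + 1))"
    if "t > 0" for t
  proof -
    have "t powr (r + 1) * gap (Z t) \<le> t powr (r + 1) * (G t \<bullet> (Z t - (xs, ys)))"
      by (intro mult_left_mono gap_le) simp
    also have "\<dots> \<le> (r + 2)\<^sup>2 * (norm (z0 - (xs, ys)))\<^sup>2 / 2"
      using weighted_gap_le[OF that] by (simp add: init)
    finally show ?thesis
      using that by (simp add: field_simps)
  qed
  have inv_lim: "((\<lambda>t. c / (2 * t powr (r + 1))) \<longlongrightarrow> 0) at_top" for c :: real
  proof -
    have "((\<lambda>t. c / 2 * t powr - (r + 1)) \<longlongrightarrow> 0) at_top"
      using r by (intro tendsto_mult_right_zero tendsto_neg_powr filterlim_ident) simp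
    then show ?thesis
      by (simp only: powr_minus_divide) simp
  qed
  have gap_lim: "((\<lambda>t. gap (Z t)) \<longlongrightarrow> 0) at_top"
    by (rule tendsto_sandwich[OF _ _ tendsto_const inv_lim])
      (auto intro: gap_nonneg bound eventually_mono[OF eventually_gt_at_top[of 0]])
  have "(Z \<longlongrightarrow> (xs, ys)) at_top"
  proof (rule tendsto_of_unique_zero[where f = Z and K = K and \<Phi> = gap])
    show "Z t \<in> K" if "t > 0" for t
      using norm_Z_le[OF that] by (simp add: K_def dist_norm norm_minus_commute init)
    show "compact K"
      by (simp add: K_def)
    show "continuous_on K gap"
      unfolding gap_def
      by (intro continuous_intros continuous_on_compose2[OF L_continuous[OF L]]) auto
  qed (use gap_pos gap_lim in auto)
  then have u_lim: "((\<lambda>t. norm (Z t - (xs, ys))) \<longlongrightarrow> 0) at_top"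
    by (intro tendsto_norm_zero) (simp add: LIM_zero)
  \<comment> \<open>The constant of \<open>norm_G_le\<close>. Cauchy-Schwarz splits the scaled gap
    into the scaled operator, bounded by \<open>M\<close>, and the distance to the saddle point,
    which vanishes in the limit.\<close>
  define M where "M = 2 * (r + 2)\<^sup>2 * norm (z0 - (xs, ys))"
  have "t powr (r + 1) * gap (Z t) \<le> M * norm (Z t - (xs, ys))" if "t > 0" for t
  proof -
    have "t powr (r + 1) * gap (Z t) \<le> t powr (r + 1) * (norm (G t) * norm (Z t - (xs, ys)))"
      by (intro mult_left_mono order_trans[OF gap_le norm_cauchy_schwarz]) simp
    also have "\<dots> \<le> M * norm (Z t - (xs, ys))"
      using mult_right_mono[OF norm_G_le[OF that] norm_ge_zero]
      by (simp add: M_def init mult.assoc)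
    finally show ?thesis .
  qed
  then have "((\<lambda>t. t powr (r + 1) * gap (Z t)) \<longlongrightarrow> 0) at_top"
    by (intro tendsto_sandwich[OF _ _ tendsto_const tendsto_mult_right_zero[OF u_lim, of M]])
      (auto simp: gap_nonneg intro: eventually_mono[OF eventually_gt_at_top[of 0]])
  with bound show ?thesis
    by (simp add: gap_def)
qed

end
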